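(* Let $R$ be a commutative ring with $1\neq 0$ and let $\tau\subset \mathrm{Reg}(R)^{\#}\times\mathrm{Reg}(R)^{\#}$ be a symmetric relation. Then the following hold. (1) If $R$ is an $r$-BFR, then $R$ is a $\tau$-$r$-BFR. (2) If $R$ is an $r$-FFR, then $R$ is a $\tau$-$r$-FFR. (3) If $R$ is an $r$-WFFR, then $R$ is a $\tau$-$r$-WFFR. (4) If $R$ satisfies $r$-ACCP, then $R$ satisfies $\tau$-$r$-ACCP.
   Context: $U(R)$ is the group of units of $R$, $\mathrm{Reg}(R)$ the set of regular elements (non-zero-divisors), $\mathrm{Reg}(R)^{\#}$ the set of regular non-units. Elements $a,b$ are associates, $a\sim b$, if $(a)=(b)$. A $\tau$-factorization of a non-unit $a$ is an expression $a=\lambda a_1\cdots a_n$, $n\ge1$, $\lambda\in U(R)$, each $a_i$ a non-unit, $a_i\,\tau\,a_j$ for all $i\ne j$. The $a_i$ are its $\tau$-factors, or $\tau$-divisors of $a$. A $\tau$-$r$-factorization is a $\tau$-factorization of an element of $\mathrm{Reg}(R)$. $R$ is a $\tau$-$r$-BFR if for each $a\in\mathrm{Reg}(R)$ there is a natural number bounding the lengths $n$ of all $\tau$-$r$-factorizations of $a$. $R$ is a $\tau$-$r$-FFR if each $a\in\mathrm{Reg}(R)^{\#}$ has only finitely many $\tau$-factorizations up to order and associates. $R$ is a $\tau$-$r$-WFFR if each $a\in\mathrm{Reg}(R)^{\#}$ has only finitely many non-associate $\tau$-divisors. $R$ satisfies $\tau$-$r$-ACCP if there is no infinite chain $(a_1)\subsetneq(a_2)\subsetneq\cdots$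 with all $a_i$ regular and $a_{i+1}$ a $\tau$-divisor in some $\tau$-$r$-factorization of $a_i$ for all $i$. The classical regular notions (of Anderson and Valdes-Leon) concern ordinary factorizations of regular elements: $R$ is an $r$-BFR if for each regular non-unit $a$ there is a bound on the lengths of factorizations of $a$ into non-units; an $r$-FFR if each regular non-unit has only finitely many factorizations into non-units up to order and associates; an $r$-WFFR if each regular non-unit has only finitely many non-associate non-unit divisors; $R$ satisfies $r$-ACCP if there is no infinite properly ascending chain of principal ideals generated by regular elements. *)

theory Defs
  imports "HOL-Algebra.Ideal" "HOL-Algebra.Divisibility"
begin

definition reg :: "('a, 'm) ring_scheme \<Rightarrow> 'a set" where
  "reg R = {a \<in> carrier R. \<forall>b \<in> carrier R. a \<otimes>\<^bsub>R\<^esub> b = \<zero>\<^bsub>R\<^esub> \<longrightarrow> b = \<zero>\<^bsub>R\<^esub>}"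

definition nonunits :: "('a, 'm) ring_scheme \<Rightarrow> 'a set" where
  "nonunits R = carrier R - Units R"

definition reg_nonunits :: "('a, 'm) ring_scheme \<Rightarrow> 'a set" where
  "reg_nonunits R = reg R - Units R"

text \<open>Associates are elements generating the same principal ideal. This is kept separate from
  \<^const>\<open>associated\<close>, which is stated by mutual divisibility.\<close>

definition assoc_rel :: "('a, 'm) ring_scheme \<Rightarrow> ('a \<times> 'a) set" where
  "assoc_rel R = {(a, b). a \<in> carrier R \<and> b \<in> carrier R \<and> PIdl\<^bsub>R\<^esub> a = PIdl\<^bsub>R\<^esub> b}"

text \<open>Equality of lists of factors up to order and associates. ``Only finitely many up to ...''
  is expressed below as finiteness of a quotient \<open>(//)\<close>.\<close>

definition factors_rel :: "('a, 'm) ring_scheme \<Rightarrow> ('a list \<times> 'a list) set" where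
  "factors_rel R = {(as, bs). \<exists>cs. mset cs = mset bs \<and> list_all2 (\<lambda>x y. (x, y) \<in> assoc_rel R) as cs}"

definition is_factorization :: "('a, 'm) ring_scheme \<Rightarrow> 'a \<Rightarrow> 'a list \<Rightarrow> bool" where
  "is_factorization R a as \<longleftrightarrow>
     a \<in> nonunits R \<and> as \<noteq> [] \<and> set as \<subseteq> nonunits R \<and> a = foldr (\<otimes>\<^bsub>R\<^esub>) as \<one>\<^bsub>R\<^esub>"

text \<open>The pair \<open>(u, as)\<close> is the factorization written \<open>a = \<lambda> a\<^sub>1 \<cdots> a\<^sub>n\<close>, with \<open>u\<close> in the role of \<open>\<lambda>\<close>.
  A factorization of length one imposes no condition on \<open>\<tau>\<close>.\<close>

definition is_tau_factorization ::
    "('a, 'm) ring_scheme \<Rightarrow> ('a \<times> 'a) set \<Rightarrow> 'a \<Rightarrow> 'a \<times> 'a list \<Rightarrow> bool" where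
  "is_tau_factorization R \<tau> a = (\<lambda>(u, as).
     a \<in> nonunits R \<and> u \<in> Units R \<and> as \<noteq> [] \<and> set as \<subseteq> nonunits R \<and>
     (\<forall>i < length as. \<forall>j < length as. i \<noteq> j \<longrightarrow> (as ! i, as ! j) \<in> \<tau>) \<and>
     a = u \<otimes>\<^bsub>R\<^esub> foldr (\<otimes>\<^bsub>R\<^esub>) as \<one>\<^bsub>R\<^esub>)"

definition is_tau_r_factorization ::
    "('a, 'm) ring_scheme \<Rightarrow> ('a \<times> 'a) set \<Rightarrow> 'a \<Rightarrow> 'a \<times> 'a list \<Rightarrow> bool" where
  "is_tau_r_factorization R \<tau> a f \<longleftrightarrow> a \<in> reg R \<and> is_tau_factorization R \<tau> a f"

definition tau_divisors :: "('a, 'm) ring_scheme \<Rightarrow> ('a \<times> 'a) set \<Rightarrow> 'a \<Rightarrow> 'a set" where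
  "tau_divisors R \<tau> a = {d. \<exists>u as. is_tau_factorization R \<tau> a (u, as) \<and> d \<in> set as}"

definition r_BFR :: "('a, 'm) ring_scheme \<Rightarrow> bool" where
  "r_BFR R \<longleftrightarrow> (\<forall>a \<in> reg_nonunits R. \<exists>N::nat. \<forall>as. is_factorization R a as \<longrightarrow> length as \<le> N)"

definition r_FFR :: "('a, 'm) ring_scheme \<Rightarrow> bool" where
  "r_FFR R \<longleftrightarrow> (\<forall>a \<in> reg_nonunits R. finite ({as. is_factorization R a as} // factors_rel R))"

definition r_WFFR :: "('a, 'm) ring_scheme \<Rightarrow> bool" where
  "r_WFFR R \<longleftrightarrow>
     (\<forall>a \<in> reg_nonunits R. finite ({d \<in> nonunits R. d divides\<^bsub>R\<^esub> a} // assoc_rel R))"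

definition r_ACCP :: "('a, 'm) ring_scheme \<Rightarrow> bool" where
  "r_ACCP R \<longleftrightarrow>
     \<not> (\<exists>a :: nat \<Rightarrow> 'a. \<forall>i. a i \<in> reg R \<and> PIdl\<^bsub>R\<^esub> (a i) \<subset> PIdl\<^bsub>R\<^esub> (a (Suc i)))"

definition tau_r_BFR :: "('a, 'm) ring_scheme \<Rightarrow> ('a \<times> 'a) set \<Rightarrow> bool" where
  "tau_r_BFR R \<tau> \<longleftrightarrow>
     (\<forall>a \<in> reg R. \<exists>N::nat. \<forall>u as. is_tau_r_factorization R \<tau> a (u, as) \<longrightarrow> length as \<le> N)"

text \<open>The unit \<open>u\<close> plays no role when comparing factorizations up to order and associates.\<close>

definition tau_r_FFR :: "('a, 'm) ring_scheme \<Rightarrow> ('a \<times> 'a) set \<Rightarrow> bool" where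
  "tau_r_FFR R \<tau> \<longleftrightarrow>
     (\<forall>a \<in> reg_nonunits R.
        finite ({f. is_tau_factorization R \<tau> a f} // inv_image (factors_rel R) snd))"

definition tau_r_WFFR :: "('a, 'm) ring_scheme \<Rightarrow> ('a \<times> 'a) set \<Rightarrow> bool" where
  "tau_r_WFFR R \<tau> \<longleftrightarrow> (\<forall>a \<in> reg_nonunits R. finite (tau_divisors R \<tau> a // assoc_rel R))"

definition tau_r_ACCP :: "('a, 'm) ring_scheme \<Rightarrow> ('a \<times> 'a) set \<Rightarrow> bool" where
  "tau_r_ACCP R \<tau> \<longleftrightarrow>
     \<not> (\<exists>a :: nat \<Rightarrow> 'a. \<forall>i. a i \<in> reg R \<and> PIdl\<^bsub>R\<^esub> (a i) \<subset> PIdl\<^bsub>R\<^esub> (a (Suc i)) \<and>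
          (\<exists>u as. is_tau_r_factorization R \<tau> (a i) (u, as) \<and> a (Suc i) \<in> set as))"

end

theory Submission
  imports Defs
begin

text \<open>
  A \<open>\<tau>\<close>-factorization becomes an ordinary factorization of the same element, with the same number
  of factors and factorwise associate to it, once its unit is multiplied into the first factor
  (lemmas \<open>is_factorization_absorb_unit\<close> and \<open>list_all2_assoc_absorb_unit\<close>). Bounds on the length
  and finiteness up to order and associates therefore pass from ordinary factorizations to
  \<open>\<tau>\<close>-factorizations. The two other claims are inclusions: a \<open>\<tau>\<close>-divisor of \<open>a\<close> is a non-unit
  divisor of \<open>a\<close>, and a chain that violates \<open>\<tau>\<close>-\<open>r\<close>-ACCP is a chain of regular principal
  ideals that violates \<open>r\<close>-ACCP.
\<close>

fun absorb_unit :: "('a, 'm) ring_scheme \<Rightarrow> 'a \<Rightarrow> 'a list \<Rightarrow> 'a list" where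
  "absorb_unit R u [] = []"
| "absorb_unit R u (x # xs) = (u \<otimes>\<^bsub>R\<^esub> x) # xs"

lemma length_absorb_unit [simp]: "length (absorb_unit R u xs) = length xs"
  by (cases xs) simp_all

lemma (in cring) unit_mult_nonunit:
  assumes u: "u \<in> Units R" and x: "x \<in> nonunits R"
  shows "u \<otimes> x \<in> nonunits R"
proof -
  have xc: "x \<in> carrier R" and xn: "x \<notin> Units R"
    using x by (auto simp: nonunits_def)
  have "u \<otimes> x \<notin> Units R"
  proof
    assume "u \<otimes> x \<in> Units R"
    hence "inv u \<otimes> (u \<otimes> x) \<in> Units R"
      using u by (simp add: Units_m_closed)
    also have "inv u \<otimes> (u \<otimes> x) = x"
      using u xc by (simp add: Units_closed m_assoc [symmetric])
    finally show False using xn by contradiction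
  qed
  thus ?thesis using u xc by (simp add: nonunits_def Units_closed)
qed

lemma (in cring) unit_mult_assoc_rel:
  assumes u: "u \<in> Units R" and x: "x \<in> carrier R"
  shows "(x, u \<otimes> x) \<in> assoc_rel R"
proof -
  have "r \<otimes> x = (r \<otimes> inv u) \<otimes> (u \<otimes> x)" if "r \<in> carrier R" for r
  proof -
    have "(r \<otimes> inv u) \<otimes> (u \<otimes> x) = r \<otimes> ((inv u \<otimes> u) \<otimes> x)"
      using that u x by (simp add: m_assoc Units_closed del: Units_l_inv)
    thus ?thesis using u x that by simp
  qed
  moreover have "r \<otimes> (u \<otimes> x) = (r \<otimes> u) \<otimes> x" if "r \<in> carrier R" for r
    using that u x by (simp add: m_assoc Units_closed)
  ultimately have "PIdl x = PIdl (u \<otimes> x)"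
    unfolding cgenideal_def using u
    by (auto intro: m_closed Units_closed Units_inv_closed) (metis m_closed Units_closed Units_inv_closed)+
  thus ?thesis using u x by (simp add: assoc_rel_def Units_closed)
qed

lemma foldr_mult_closed:
  assumes "monoid R" and "set xs \<subseteq> carrier R"
  shows "foldr (\<otimes>\<^bsub>R\<^esub>) xs \<one>\<^bsub>R\<^esub> \<in> carrier R"
  using assms(2) by (induction xs) (auto intro: monoid.m_closed [OF assms(1)] monoid.one_closed [OF assms(1)])

lemma (in cring) is_factorization_absorb_unit:
  assumes "is_tau_factorization R \<tau> a (u, xs)"
  shows "is_factorization R a (absorb_unit R u xs)"
proof (cases xs)
  case Nil
  thus ?thesis using assms by (simp add: is_tau_factorization_def)
next
  case (Cons y ys)
  have a: "a \<in> nonunits R" and u: "u \<in> Units R" and y: "y \<in> nonunits R"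
    and ys: "set ys \<subseteq> nonunits R" and eq: "a = u \<otimes> (y \<otimes> foldr (\<otimes>) ys \<one>)"
    using assms Cons by (auto simp: is_tau_factorization_def)
  have "foldr (\<otimes>) ys \<one> \<in> carrier R"
    using ys by (intro foldr_mult_closed) (auto simp: nonunits_def intro: monoid_axioms)
  hence "a = (u \<otimes> y) \<otimes> foldr (\<otimes>) ys \<one>"
    using eq u y by (simp add: m_assoc nonunits_def Units_closed)
  thus ?thesis
    using a ys unit_mult_nonunit [OF u y] Cons by (simp add: is_factorization_def)
qed

lemma (in cring) list_all2_assoc_absorb_unit:
  assumes "u \<in> Units R" and "set xs \<subseteq> carrier R"
  shows "list_all2 (\<lambda>x y. (x, y) \<in> assoc_rel R) xs (absorb_unit R u xs)"
proof (cases xs)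
  case (Cons y ys)
  have "list_all2 (\<lambda>x y. (x, y) \<in> assoc_rel R) ys ys"
    using assms Cons by (intro list.rel_refl_strong) (auto simp: assoc_rel_def)
  thus ?thesis using assms Cons by (simp add: unit_mult_assoc_rel)
qed simp

text \<open>
  No rearrangement of factors occurs here: as associateness is symmetric and transitive, a list
  of factors is factorwise associate to the first list exactly when it is to the second one.
\<close>

lemma factors_rel_class_eq:
  assumes "list_all2 (\<lambda>x y. (x, y) \<in> assoc_rel R) xs ys"
  shows "factors_rel R `` {xs} = factors_rel R `` {ys}"
proof -
  have "list_all2 (\<lambda>x y. (x, y) \<in> assoc_rel R) xs zs
        \<longleftrightarrow> list_all2 (\<lambda>x y. (x, y) \<in> assoc_rel R) ys zs" for zs
    using assms by (auto simp: list_all2_conv_all_nth assoc_rel_def)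
  thus ?thesis by (simp add: factors_rel_def)
qed

lemma (in cring) member_divides_foldr_mult:
  assumes "set xs \<subseteq> carrier R" and "d \<in> set xs"
  shows "d divides foldr (\<otimes>) xs \<one>"
  using assms
proof (induction xs)
  case (Cons y ys)
  hence closed: "y \<in> carrier R" "d \<in> carrier R" "foldr (\<otimes>) ys \<one> \<in> carrier R"
    by (auto intro: foldr_mult_closed monoid_axioms)
  show ?case
  proof (cases "d = y")
    case True
    thus ?thesis using closed by auto
  next
    case False
    hence "d divides foldr (\<otimes>) ys \<one>" using Cons by simp
    thus ?thesis using closed by (simp add: divides_prod_l)
  qed
qed simp

lemma (in cring) tau_divisors_subset:
  "tau_divisors R \<tau> a \<subseteq> {d \<in> nonunits R. d divides a}"
proof
  fix d
  assume "d \<in> tau_divisors R \<tau> a"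
  then obtain u xs where u: "u \<in> Units R" and xs: "set xs \<subseteq> nonunits R"
    and eq: "a = u \<otimes> foldr (\<otimes>) xs \<one>" and d: "d \<in> set xs"
    by (auto simp: tau_divisors_def is_tau_factorization_def)
  have xs_closed: "set xs \<subseteq> carrier R" using xs by (auto simp: nonunits_def)
  have "d divides (u \<otimes> foldr (\<otimes>) xs \<one>)"
  proof (rule divides_prod_l)
    show "d \<in> carrier R" using xs_closed d by auto
    show "foldr (\<otimes>) xs \<one> \<in> carrier R"
      by (rule foldr_mult_closed [OF monoid_axioms xs_closed])
    show "d divides foldr (\<otimes>) xs \<one>"
      by (rule member_divides_foldr_mult [OF xs_closed d])
  qed (use u in auto)
  thus "d \<in> {d \<in> nonunits R. d divides a}" using xs d eq by auto
qed

lemma quotient_mono: "A \<subseteq> B \<Longrightarrow> A // r \<subseteq> B // r"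
  by (auto simp: quotient_def)

text \<open>
  A regular unit has no factorization into non-units at all, so only regular non-units need
  a bound.
\<close>

lemma (in cring) r_BFR_imp_tau_r_BFR:
  assumes "r_BFR R"
  shows "tau_r_BFR R \<tau>"
  unfolding tau_r_BFR_def
proof
  fix a assume a: "a \<in> reg R"
  show "\<exists>N. \<forall>u xs. is_tau_r_factorization R \<tau> a (u, xs) \<longrightarrow> length xs \<le> N"
  proof (cases "a \<in> Units R")
    case True
    thus ?thesis
      by (auto simp: is_tau_r_factorization_def is_tau_factorization_def nonunits_def)
  next
    case False
    then obtain N where "\<forall>xs. is_factorization R a xs \<longrightarrow> length xs \<le> N"
      using assms a by (auto simp: r_BFR_def reg_nonunits_def)
    hence "length xs \<le> N" if "is_tau_r_factorization R \<tau> a (u, xs)" for u xs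
      using that is_factorization_absorb_unit [of \<tau> a u xs]
      by (auto simp: is_tau_r_factorization_def)
    thus ?thesis by blast
  qed
qed

text \<open>
  The class of a \<open>\<tau>\<close>-factorization is the preimage, under forgetting the unit, of the class of
  the factorization that absorbs the unit. There are thus at most as many classes of
  \<open>\<tau>\<close>-factorizations as of factorizations.
\<close>

lemma (in cring) r_FFR_imp_tau_r_FFR:
  assumes "r_FFR R"
  shows "tau_r_FFR R \<tau>"
  unfolding tau_r_FFR_def
proof
  fix a assume "a \<in> reg_nonunits R"
  hence fin: "finite ({xs. is_factorization R a xs} // factors_rel R)"
    using assms by (simp add: r_FFR_def)
  have "{f. is_tau_factorization R \<tau> a f} // inv_image (factors_rel R) snd
        \<subseteq> (\<lambda>C. snd -` C) ` ({xs. is_factorization R a xs} // factors_rel R)"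
  proof
    fix C assume "C \<in> {f. is_tau_factorization R \<tau> a f} // inv_image (factors_rel R) snd"
    then obtain u xs where f: "is_tau_factorization R \<tau> a (u, xs)"
      and C: "C = inv_image (factors_rel R) snd `` {(u, xs)}"
      by (auto elim!: quotientE)
    have "u \<in> Units R" "set xs \<subseteq> carrier R"
      using f by (auto simp: is_tau_factorization_def nonunits_def)
    hence "factors_rel R `` {xs} = factors_rel R `` {absorb_unit R u xs}"
      by (intro factors_rel_class_eq list_all2_assoc_absorb_unit)
    moreover have "C = snd -` (factors_rel R `` {xs})"
      using C by (auto simp: inv_image_def)
    ultimately have "C = snd -` (factors_rel R `` {absorb_unit R u xs})" by simp
    moreover have "factors_rel R `` {absorb_unit R u xs}
        \<in> {xs. is_factorization R a xs} // factors_rel R"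
      using is_factorization_absorb_unit [OF f] by (intro quotientI) simp
    ultimately show "C \<in> (\<lambda>C. snd -` C) ` ({xs. is_factorization R a xs} // factors_rel R)"
      by (rule image_eqI)
  qed
  thus "finite ({f. is_tau_factorization R \<tau> a f} // inv_image (factors_rel R) snd)"
    using fin by (meson finite_imageI finite_subset)
qed

lemma (in cring) r_WFFR_imp_tau_r_WFFR:
  assumes "r_WFFR R"
  shows "tau_r_WFFR R \<tau>"
  using assms quotient_mono [OF tau_divisors_subset]
  unfolding r_WFFR_def tau_r_WFFR_def by (meson finite_subset)

lemma r_ACCP_imp_tau_r_ACCP: "r_ACCP R \<Longrightarrow> tau_r_ACCP R \<tau>"
  unfolding r_ACCP_def tau_r_ACCP_def by blast

theorem theorem5p2:
  fixes R :: "('a, 'm) ring_scheme" and \<tau> :: "('a \<times> 'a) set"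
  assumes "cring R"
    and "\<one>\<^bsub>R\<^esub> \<noteq> \<zero>\<^bsub>R\<^esub>"
    and "\<tau> \<subseteq> reg_nonunits R \<times> reg_nonunits R"
    and "sym \<tau>"
  shows "(r_BFR R \<longrightarrow> tau_r_BFR R \<tau>) \<and>
         (r_FFR R \<longrightarrow> tau_r_FFR R \<tau>) \<and>
         (r_WFFR R \<longrightarrow> tau_r_WFFR R \<tau>) \<and>
         (r_ACCP R \<longrightarrow> tau_r_ACCP R \<tau>)"
  using cring.r_BFR_imp_tau_r_BFR [OF assms(1)] cring.r_FFR_imp_tau_r_FFR [OF assms(1)]
    cring.r_WFFR_imp_tau_r_WFFR [OF assms(1)] r_ACCP_imp_tau_r_ACCP
  by blast

end
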